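(* Let $n\ge1$, $r>1$, $\sigma_0>0$ and $s\in\mathbb{R}$. The space $\mathcal T^s(\mathbb{R}^n)$ is a Hilbert space with respect to the inner product $$\langle u,v\rangle_{\mathcal T^s}=\langle u,v\rangle_{L^2}+\sum_{j\in\mathbb{Z}}r^{2js}\langle u*\Phi_j,v*\Phi_j\rangle_{L^2}.$$
   Context: Functions are real-valued. For $\sigma>0$ let $\gamma_\sigma(x)=(2\pi\sigma^2)^{-n/2}\exp(-|x|^2/(2\sigma^2))$ on $\mathbb{R}^n$; the Fourier transform is $\hat u(\xi)=\int_{\mathbb{R}^n}u(x)e^{-ix\cdot\xi}\,dx$. Fix $r>1$, $\sigma_0>0$. Put $\Phi_0=\gamma_{\sigma_0}-\gamma_{\sigma_0/r}$ and, for $j\in\mathbb{Z}$, let $\Phi_j$ be the function with $\widehat{\Phi_j}(\xi)=\widehat{\Phi_0}(r^{-j}\xi)$, i.e. $\Phi_j=\gamma_{r^{-j}\sigma_0}-\gamma_{r^{-j-1}\sigma_0}$. The texture Hilbert space is $$\mathcal T^s(\mathbb{R}^n)=\Big\{u\in L^2(\mathbb{R}^n):\sum_{j\in\mathbb{Z}}r^{2js}\|u*\Phi_j\|_{L^2}^2<\infty\Big\}.$$ *)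

theory Defs
  imports "HOL-Probability.Probability"
begin

section \<open>Real-valued square-integrable functions\<close>

text \<open>Every Lebesgue measurable function agrees almost everywhere with a Borel measurable one,
  so it suffices to take Borel measurable representatives.\<close>

definition square_integrable :: "(real ^ 'n::finite \<Rightarrow> real) \<Rightarrow> bool" where
  "square_integrable f \<longleftrightarrow>
     f \<in> borel_measurable lborel \<and> integrable lborel (\<lambda>x. (f x)\<^sup>2)"

definition L2_eq :: "(real ^ 'n::finite \<Rightarrow> real) \<Rightarrow> (real ^ 'n \<Rightarrow> real) \<Rightarrow> bool" where
  "L2_eq f g \<longleftrightarrow>
     square_integrable f \<and> square_integrable g \<and> (AE x in lborel. f x = g x)"

lemma square_integrable_measurable [measurable_dest]:
  "square_integrable f \<Longrightarrow> f \<in> borel_measurable borel"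
  by (simp add: square_integrable_def)

lemma square_integrable_zero: "square_integrable (\<lambda>x. 0)"
  by (simp add: square_integrable_def)

lemma square_integrable_mult:
  assumes "square_integrable f" "square_integrable g"
  shows "integrable lborel (\<lambda>x. f x * g x)"
proof (rule Bochner_Integration.integrable_bound)
  show "integrable lborel (\<lambda>x. (f x)\<^sup>2 + (g x)\<^sup>2)"
    using assms by (auto simp: square_integrable_def)
  show "(\<lambda>x. f x * g x) \<in> borel_measurable lborel"
    using assms by measurable
  have "\<bar>a\<bar> * \<bar>b\<bar> \<le> a\<^sup>2 + b\<^sup>2" for a b :: real
  proof -
    have "2 * (\<bar>a\<bar> * \<bar>b\<bar>) \<le> a\<^sup>2 + b\<^sup>2"
      using sum_squares_bound[of "\<bar>a\<bar>" "\<bar>b\<bar>"] by (simp add: mult.assoc)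
    moreover have "0 \<le> \<bar>a\<bar> * \<bar>b\<bar>"
      by simp
    ultimately show ?thesis
      by linarith
  qed
  then show "AE x in lborel. norm (f x * g x) \<le> norm ((f x)\<^sup>2 + (g x)\<^sup>2)"
    by (simp add: abs_mult)
qed

lemma square_integrable_add:
  assumes "square_integrable f" "square_integrable g"
  shows "square_integrable (\<lambda>x. f x + g x)"
  using assms square_integrable_mult[OF assms]
  by (auto simp: square_integrable_def power2_sum mult.assoc)

lemma square_integrable_scale:
  "square_integrable f \<Longrightarrow> square_integrable (\<lambda>x. c * f x)"
  by (auto simp: square_integrable_def power_mult_distrib)

lemma L2_eq_trans:
  assumes fg: "L2_eq f g" and gh: "L2_eq g h"
  shows "L2_eq f h"
proof -
  have "AE x in lborel. f x = g x" "AE x in lborel. g x = h x"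
    using assms by (simp_all add: L2_eq_def)
  then have "AE x in lborel. f x = h x"
    by eventually_elim simp
  with fg gh show ?thesis
    by (simp add: L2_eq_def)
qed

quotient_type (overloaded) 'n L2 = "real ^ 'n::finite \<Rightarrow> real" / partial: L2_eq
proof (rule part_equivpI)
  show "\<exists>f. L2_eq f f"
    using square_integrable_zero by (auto simp: L2_eq_def)
  show "symp L2_eq"
    by (auto simp: symp_def L2_eq_def)
  show "transp L2_eq"
    by (rule transpI) (rule L2_eq_trans)
qed

instantiation L2 :: (finite) real_vector
begin

lift_definition zero_L2 :: "'a L2" is "\<lambda>x. 0"
  by (simp add: L2_eq_def square_integrable_zero)

lift_definition plus_L2 :: "'a L2 \<Rightarrow> 'a L2 \<Rightarrow> 'a L2" is "\<lambda>f g x. f x + g x"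
proof -
  fix f f' g g' :: "real ^ 'a \<Rightarrow> real"
  assume f: "L2_eq f f'" and g: "L2_eq g g'"
  have "AE x in lborel. f x = f' x" "AE x in lborel. g x = g' x"
    using f g by (simp_all add: L2_eq_def)
  then have "AE x in lborel. f x + g x = f' x + g' x"
    by eventually_elim simp
  with f g show "L2_eq (\<lambda>x. f x + g x) (\<lambda>x. f' x + g' x)"
    by (simp add: L2_eq_def square_integrable_add)
qed

lift_definition scaleR_L2 :: "real \<Rightarrow> 'a L2 \<Rightarrow> 'a L2" is "\<lambda>c f x. c * f x"
proof -
  fix c :: real and f f' :: "real ^ 'a \<Rightarrow> real"
  assume "L2_eq f f'"
  then show "L2_eq (\<lambda>x. c * f x) (\<lambda>x. c * f' x)"
    by (auto simp: L2_eq_def square_integrable_scale elim: eventually_mono)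
qed

definition uminus_L2 :: "'a L2 \<Rightarrow> 'a L2" where
  "uminus_L2 u = (-1) *\<^sub>R u"

definition minus_L2 :: "'a L2 \<Rightarrow> 'a L2 \<Rightarrow> 'a L2" where
  "minus_L2 u v = u + - v"

instance
proof
  fix a b :: real and u v w :: "'a L2"
  show "u + v + w = u + (v + w)"
    by transfer (auto simp: L2_eq_def ac_simps intro!: square_integrable_add)
  show "u + v = v + u"
    by transfer (auto simp: L2_eq_def ac_simps intro!: square_integrable_add)
  show "0 + u = u"
    by transfer (auto simp: L2_eq_def)
  show "- u + u = 0"
    unfolding uminus_L2_def
    by transfer (auto simp: L2_eq_def square_integrable_zero)
  show "u - v = u + - v"
    by (simp add: minus_L2_def)
  show "a *\<^sub>R (u + v) = a *\<^sub>R u + a *\<^sub>R v"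
    by transfer (auto simp: L2_eq_def algebra_simps
        intro!: square_integrable_add square_integrable_scale)
  show "(a + b) *\<^sub>R u = a *\<^sub>R u + b *\<^sub>R u"
    by transfer (auto simp: L2_eq_def algebra_simps
        intro!: square_integrable_add square_integrable_scale)
  show "a *\<^sub>R b *\<^sub>R u = (a * b) *\<^sub>R u"
    by transfer (auto simp: L2_eq_def ac_simps intro!: square_integrable_scale)
  show "1 *\<^sub>R u = u"
    by transfer (auto simp: L2_eq_def)
qed

end

instantiation L2 :: (finite) real_inner
begin

lift_definition inner_L2 :: "'a L2 \<Rightarrow> 'a L2 \<Rightarrow> real"
  is "\<lambda>f g. \<integral>x. f x * g x \<partial>lborel"
proof -
  fix f f' g g' :: "real ^ 'a \<Rightarrow> real"
  assume f: "L2_eq f f'" and g: "L2_eq g g'"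
  show "(\<integral>x. f x * g x \<partial>lborel) = (\<integral>x. f' x * g' x \<partial>lborel)"
  proof (rule integral_cong_AE)
    show "(\<lambda>x. f x * g x) \<in> borel_measurable lborel" "(\<lambda>x. f' x * g' x) \<in> borel_measurable lborel"
      using f g by (auto simp: L2_eq_def square_integrable_def)
    have "AE x in lborel. f x = f' x" "AE x in lborel. g x = g' x"
      using f g by (auto simp: L2_eq_def)
    then show "AE x in lborel. f x * g x = f' x * g' x"
      by eventually_elim simp
  qed
qed

definition norm_L2 :: "'a L2 \<Rightarrow> real" where
  "norm_L2 u = sqrt (u \<bullet> u)"

definition dist_L2 :: "'a L2 \<Rightarrow> 'a L2 \<Rightarrow> real" where
  "dist_L2 u v = norm (u - v)"

definition sgn_L2 :: "'a L2 \<Rightarrow> 'a L2" where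
  "sgn_L2 u = u /\<^sub>R norm u"

definition uniformity_L2 :: "('a L2 \<times> 'a L2) filter" where
  "uniformity_L2 = (INF e\<in>{0<..}. principal {(u, v). dist u v < e})"

definition open_L2 :: "'a L2 set \<Rightarrow> bool" where
  "open_L2 U \<longleftrightarrow> (\<forall>u\<in>U. eventually (\<lambda>(u', v). u' = u \<longrightarrow> v \<in> U) uniformity)"

instance
proof
  fix a :: real and u v w :: "'a L2" and U :: "'a L2 set"
  show "dist u v = norm (u - v)"
    by (simp add: dist_L2_def)
  show "sgn u = u /\<^sub>R norm u"
    by (simp add: sgn_L2_def)
  show "uniformity = (INF e\<in>{0<..}. principal {(u :: 'a L2, v). dist u v < e})"
    by (simp add: uniformity_L2_def)
  show "open U \<longleftrightarrow> (\<forall>u\<in>U. eventually (\<lambda>(u', v). u' = u \<longrightarrow> v \<in> U) uniformity)"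
    by (simp add: open_L2_def)
  show "u \<bullet> v = v \<bullet> u"
    by transfer (simp add: mult.commute)
  show "(u + v) \<bullet> w = u \<bullet> w + v \<bullet> w"
    by transfer (simp add: L2_eq_def distrib_right square_integrable_mult)
  show "(a *\<^sub>R u) \<bullet> v = a * (u \<bullet> v)"
    by transfer (simp add: mult.assoc)
  show "0 \<le> u \<bullet> u"
    by transfer simp
  show "u \<bullet> u = 0 \<longleftrightarrow> u = 0"
  proof transfer
    fix f :: "real ^ 'a \<Rightarrow> real"
    assume "L2_eq f f"
    then have f: "square_integrable f"
      by (simp add: L2_eq_def)
    then have "(\<integral>x. f x * f x \<partial>lborel) = 0 \<longleftrightarrow> (AE x in lborel. f x * f x = 0)"
      using square_integrable_mult[OF f f] by (intro integral_nonneg_eq_0_iff_AE) auto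
    with f show "(\<integral>x. f x * f x \<partial>lborel) = 0 \<longleftrightarrow> L2_eq f (\<lambda>x. 0)"
      by (simp add: L2_eq_def square_integrable_zero)
  qed
  show "norm u = sqrt (u \<bullet> u)"
    by (simp add: norm_L2_def)
qed

end


section \<open>Convolution with differences of Gaussians\<close>

definition gaussian :: "real \<Rightarrow> real ^ 'n::finite \<Rightarrow> real" where
  "gaussian \<sigma> x =
     (2 * pi * \<sigma>\<^sup>2) powr (- (real CARD('n) / 2)) * exp (- ((norm x)\<^sup>2 / (2 * \<sigma>\<^sup>2)))"

text \<open>The Fourier transform of \<open>gaussian \<sigma>\<close> is \<open>exp (- \<sigma>\<^sup>2 |\<xi>|\<^sup>2 / 2)\<close>, so that the Fourier
  transform of \<open>Phi r \<sigma>\<^sub>0 j\<close> at \<open>\<xi>\<close> is that of \<open>Phi r \<sigma>\<^sub>0 0\<close> at \<open>r powi (-j) *\<^sub>R \<xi>\<close>.\<close>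

definition Phi :: "real \<Rightarrow> real \<Rightarrow> int \<Rightarrow> real ^ 'n::finite \<Rightarrow> real" where
  "Phi r \<sigma>\<^sub>0 j x = gaussian (r powi (-j) * \<sigma>\<^sub>0) x - gaussian (r powi (-j-1) * \<sigma>\<^sub>0) x"

definition convolve ::
    "(real ^ 'n::finite \<Rightarrow> real) \<Rightarrow> (real ^ 'n \<Rightarrow> real) \<Rightarrow> real ^ 'n \<Rightarrow> real" where
  "convolve f k x = (\<integral>y. f y * k (x - y) \<partial>lborel)"

lemma integrable_gaussian: "integrable lborel (gaussian \<sigma> :: real ^ 'n::finite \<Rightarrow> real)"
proof (cases "\<sigma> = 0")
  case True
  then show ?thesis by (simp add: gaussian_def [abs_def])
next
  case False
  define h :: "real \<Rightarrow> real" where "h t = exp (- (t\<^sup>2 / (2 * \<sigma>\<^sup>2)))" for t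
  have h_meas [measurable]: "h \<in> borel_measurable borel"
    unfolding h_def by measurable
  have "integrable lborel (normal_density 0 \<bar>\<sigma>\<bar>)"
    using False by (intro integrable_normal_density) auto
  then have "integrable lborel (\<lambda>t. sqrt (2 * pi * \<sigma>\<^sup>2) * normal_density 0 \<bar>\<sigma>\<bar> t)"
    by simp
  also have "(\<lambda>t. sqrt (2 * pi * \<sigma>\<^sup>2) * normal_density 0 \<bar>\<sigma>\<bar> t) = h"
    using False by (auto simp: normal_density_def h_def fun_eq_iff)
  finally have h: "(\<integral>\<^sup>+t. h t \<partial>lborel) < \<infinity>"
    by (auto simp: integrable_iff_bounded h_def)
  have eq: "exp (- ((norm x)\<^sup>2 / (2 * \<sigma>\<^sup>2))) = (\<Prod>b\<in>Basis. h (x \<bullet> b))" for x :: "real ^ 'n"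
  proof -
    have "(norm x)\<^sup>2 = (\<Sum>b\<in>Basis. (x \<bullet> b)\<^sup>2)"
      unfolding power2_norm_eq_inner by (subst euclidean_inner) (simp add: power2_eq_square)
    then show ?thesis
      by (simp add: h_def exp_sum [symmetric] sum_divide_distrib sum_negf)
  qed
  have "(\<integral>\<^sup>+x. (\<Prod>b\<in>(Basis :: (real ^ 'n) set). ennreal (h (x \<bullet> b))) \<partial>lborel)
      = (\<Prod>b\<in>(Basis :: (real ^ 'n) set). (\<integral>\<^sup>+t. h t \<partial>lborel))"
    by (rule nn_integral_lborel_prod) (auto simp: h_def)
  also have "\<dots> < \<infinity>"
    using h by (simp add: power_less_top_ennreal)
  finally have "integrable lborel (\<lambda>x :: real ^ 'n. exp (- ((norm x)\<^sup>2 / (2 * \<sigma>\<^sup>2))))"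
    by (intro integrableI_bounded) (simp_all add: eq prod_ennreal h_def prod_nonneg abs_prod)
  then show ?thesis
    by (simp add: gaussian_def [abs_def])
qed

lemma integrable_Phi: "integrable lborel (Phi r \<sigma>\<^sub>0 j)"
  unfolding Phi_def [abs_def] by (intro Bochner_Integration.integrable_diff integrable_gaussian)

lemma Cauchy_Schwarz_weighted:
  fixes f k :: "'a \<Rightarrow> real"
  assumes [measurable]: "f \<in> borel_measurable M" and k: "integrable M k"
    and fk: "integrable M (\<lambda>y. (f y)\<^sup>2 * \<bar>k y\<bar>)"
  shows "(\<integral>y. f y * k y \<partial>M)\<^sup>2 \<le> (\<integral>y. \<bar>k y\<bar> \<partial>M) * (\<integral>y. (f y)\<^sup>2 * \<bar>k y\<bar> \<partial>M)"
proof -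
  have [measurable]: "k \<in> borel_measurable M"
    using k by auto
  have k': "integrable M (\<lambda>y. \<bar>k y\<bar>)"
    using k by simp
  define A K B where "A = (\<integral>y. \<bar>f y\<bar> * \<bar>k y\<bar> \<partial>M)" and "K = (\<integral>y. \<bar>k y\<bar> \<partial>M)"
    and "B = (\<integral>y. (f y)\<^sup>2 * \<bar>k y\<bar> \<partial>M)"
  have bound: "\<bar>a\<bar> \<le> 1 + a\<^sup>2" for a :: real
    using sum_squares_bound[of 1 "\<bar>a\<bar>"] by simp
  have fk1: "integrable M (\<lambda>y. \<bar>f y\<bar> * \<bar>k y\<bar>)"
  proof (rule Bochner_Integration.integrable_bound)
    show "integrable M (\<lambda>y. \<bar>k y\<bar> + (f y)\<^sup>2 * \<bar>k y\<bar>)"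
      using k' fk by simp
    have "\<bar>a\<bar> * \<bar>b\<bar> \<le> \<bar>b\<bar> + a\<^sup>2 * \<bar>b\<bar>" for a b :: real
      using mult_right_mono[OF bound[of a], of "\<bar>b\<bar>"] by (simp add: distrib_right)
    then show "AE y in M. norm (\<bar>f y\<bar> * \<bar>k y\<bar>) \<le> norm (\<bar>k y\<bar> + (f y)\<^sup>2 * \<bar>k y\<bar>)"
      by (simp add: abs_mult)
  qed measurable
  have "A\<^sup>2 \<le> K * B"
  proof (cases "K = 0")
    case True
    then have "AE y in M. \<bar>k y\<bar> = 0"
      using integral_nonneg_eq_0_iff_AE[OF k'] by (simp add: K_def)
    then have "AE y in M. \<bar>f y\<bar> * \<bar>k y\<bar> = 0"
      by eventually_elim simp
    then have "A = 0"
      unfolding A_def by (rule integral_eq_zero_AE)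
    with True show ?thesis by simp
  next
    case False
    moreover have "0 \<le> K"
      by (simp add: K_def)
    ultimately have K: "K > 0"
      by simp
    have "0 \<le> (\<integral>y. (K * \<bar>f y\<bar> - A)\<^sup>2 * \<bar>k y\<bar> \<partial>M)"
      by simp
    also have "\<dots> = (\<integral>y. K\<^sup>2 * ((f y)\<^sup>2 * \<bar>k y\<bar>) - (2 * K * A) * (\<bar>f y\<bar> * \<bar>k y\<bar>) + A\<^sup>2 * \<bar>k y\<bar> \<partial>M)"
      by (intro Bochner_Integration.integral_cong refl) (simp add: power2_eq_square algebra_simps)
    also have "\<dots> = K\<^sup>2 * B - (2 * K * A) * A + A\<^sup>2 * K"
      using fk fk1 k' by (simp add: A_def B_def K_def)
    also have "\<dots> = K * (K * B - A\<^sup>2)"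
      by (simp add: power2_eq_square algebra_simps)
    finally show ?thesis
      using K by (simp add: zero_le_mult_iff)
  qed
  moreover have "\<bar>\<integral>y. f y * k y \<partial>M\<bar> \<le> A"
    using integral_abs_bound[of M "\<lambda>y. f y * k y"] by (simp add: A_def abs_mult)
  then have "(\<integral>y. f y * k y \<partial>M)\<^sup>2 \<le> A\<^sup>2"
    using power_mono[of "\<bar>\<integral>y. f y * k y \<partial>M\<bar>" A 2] by simp
  ultimately show ?thesis
    by (simp add: K_def B_def)
qed

lemma nn_integral_lborel_shift:
  fixes g :: "real ^ 'n::finite \<Rightarrow> ennreal"
  assumes [measurable]: "g \<in> borel_measurable borel"
  shows "(\<integral>\<^sup>+x. g (x - y) \<partial>lborel) = (\<integral>\<^sup>+x. g x \<partial>lborel)"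
proof -
  have "(\<integral>\<^sup>+x. g x \<partial>lborel) = (\<integral>\<^sup>+x. g x \<partial>distr lborel borel ((+) (- y)))"
    by (simp add: lborel_distr_plus)
  also have "\<dots> = (\<integral>\<^sup>+x. g (- y + x) \<partial>lborel)"
    by (rule nn_integral_distr) auto
  finally show ?thesis by simp
qed

lemma nn_integral_lborel_reflect:
  fixes g :: "real ^ 'n::finite \<Rightarrow> ennreal"
  assumes [measurable]: "g \<in> borel_measurable borel"
  shows "(\<integral>\<^sup>+y. g (x - y) \<partial>lborel) = (\<integral>\<^sup>+y. g y \<partial>lborel)"
proof -
  have "density (distr lborel borel (\<lambda>y. x + (-1) *\<^sub>R y)) (\<lambda>_. ennreal (\<bar>-1\<bar> ^ DIM(real ^ 'n)))
      = distr lborel borel (\<lambda>y. x - y)"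
    by (simp add: density_1)
  then have "lborel = distr lborel borel (\<lambda>y. x - y)"
    using lborel_affine[of "-1" x] by (rule trans[rotated]) simp
  then have "(\<integral>\<^sup>+y. g y \<partial>lborel) = (\<integral>\<^sup>+y. g y \<partial>distr lborel borel (\<lambda>y. x - y))"
    by (rule arg_cong)
  also have "\<dots> = (\<integral>\<^sup>+y. g (x - y) \<partial>lborel)"
    by (rule nn_integral_distr) auto
  finally show ?thesis by simp
qed

text \<open>Young's inequality, in the form that convolution with an integrable kernel preserves
  square integrability.\<close>

lemma square_integrable_convolve:
  fixes f k :: "real ^ 'n::finite \<Rightarrow> real"
  assumes f: "square_integrable f" and k: "integrable lborel k"
  shows "square_integrable (convolve f k)"
proof -
  have f_meas [measurable]: "f \<in> borel_measurable borel"
    using f by (simp add: square_integrable_def)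
  have k_meas [measurable]: "k \<in> borel_measurable borel"
    using k by auto
  have conv_meas [measurable]: "convolve f k \<in> borel_measurable borel"
    unfolding convolve_def [abs_def] by measurable
  define K where "K = (\<integral>y. \<bar>k y\<bar> \<partial>lborel)"
  have K_nn: "(\<integral>\<^sup>+y. ennreal \<bar>k y\<bar> \<partial>lborel) = ennreal K"
    unfolding K_def using k by (intro nn_integral_eq_integral) auto
  have K0: "0 \<le> K"
    unfolding K_def by (rule Bochner_Integration.integral_nonneg) simp
  have k_int: "integrable lborel (\<lambda>y. k (x - y))" for x
  proof (rule integrableI_bounded)
    have "(\<integral>\<^sup>+y. ennreal \<bar>k (x - y)\<bar> \<partial>lborel) = ennreal K"
      using nn_integral_lborel_reflect[of "\<lambda>y. ennreal \<bar>k y\<bar>" x] K_nn by simp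
    then show "(\<integral>\<^sup>+y. ennreal (norm (k (x - y))) \<partial>lborel) < \<infinity>"
      by simp
  qed measurable
  have K_eq: "(\<integral>y. \<bar>k (x - y)\<bar> \<partial>lborel) = K" for x
  proof -
    have "ennreal (\<integral>y. \<bar>k (x - y)\<bar> \<partial>lborel) = (\<integral>\<^sup>+y. ennreal \<bar>k (x - y)\<bar> \<partial>lborel)"
      using k_int[of x] by (intro nn_integral_eq_integral [symmetric]) auto
    also have "\<dots> = ennreal K"
      using nn_integral_lborel_reflect[of "\<lambda>y. ennreal \<bar>k y\<bar>" x] K_nn by simp
    finally show ?thesis
      using K0 by simp
  qed
  define J where "J x = (\<integral>\<^sup>+y. ennreal ((f y)\<^sup>2 * \<bar>k (x - y)\<bar>) \<partial>lborel)" for x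
  have J_meas [measurable]: "J \<in> borel_measurable borel"
    unfolding J_def [abs_def] by measurable
  have F: "(\<integral>\<^sup>+y. ennreal ((f y)\<^sup>2) \<partial>lborel) < \<infinity>"
    using f by (auto simp: square_integrable_def integrable_iff_bounded)
  have "(\<integral>\<^sup>+x. J x \<partial>lborel)
      = (\<integral>\<^sup>+y. (\<integral>\<^sup>+x. ennreal ((f y)\<^sup>2 * \<bar>k (x - y)\<bar>) \<partial>lborel) \<partial>lborel)"
    unfolding J_def by (rule lborel_pair.Fubini') measurable
  also have "\<dots> = (\<integral>\<^sup>+y. ennreal ((f y)\<^sup>2) * (\<integral>\<^sup>+x. ennreal \<bar>k (x - y)\<bar> \<partial>lborel) \<partial>lborel)"
    by (simp add: ennreal_mult nn_integral_cmult)
  also have "\<dots> = (\<integral>\<^sup>+y. ennreal ((f y)\<^sup>2) * ennreal K \<partial>lborel)"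
    using nn_integral_lborel_shift[of "\<lambda>y. ennreal \<bar>k y\<bar>"] K_nn by simp
  also have "\<dots> = (\<integral>\<^sup>+y. ennreal ((f y)\<^sup>2) \<partial>lborel) * ennreal K"
    by (rule nn_integral_multc) measurable
  also have "\<dots> < \<infinity>"
    using F by (simp add: ennreal_mult_less_top)
  finally have J_fin: "(\<integral>\<^sup>+x. J x \<partial>lborel) < \<infinity>" .
  have "AE x in lborel. J x \<noteq> \<infinity>"
    using J_fin by (intro nn_integral_PInf_AE) auto
  then have le: "AE x in lborel. ennreal ((convolve f k x)\<^sup>2) \<le> ennreal K * J x"
  proof eventually_elim
    fix x assume Jx: "J x \<noteq> \<infinity>"
    have int: "integrable lborel (\<lambda>y. (f y)\<^sup>2 * \<bar>k (x - y)\<bar>)"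
    proof (rule integrableI_nonneg)
      show "(\<integral>\<^sup>+y. ennreal ((f y)\<^sup>2 * \<bar>k (x - y)\<bar>) \<partial>lborel) < \<infinity>"
        using Jx by (simp add: J_def top.not_eq_extremum)
    qed auto
    have "(convolve f k x)\<^sup>2 \<le> K * (\<integral>y. (f y)\<^sup>2 * \<bar>k (x - y)\<bar> \<partial>lborel)"
      using Cauchy_Schwarz_weighted[OF _ k_int[of x] int] by (simp add: convolve_def K_eq)
    then have "ennreal ((convolve f k x)\<^sup>2)
        \<le> ennreal K * ennreal (\<integral>y. (f y)\<^sup>2 * \<bar>k (x - y)\<bar> \<partial>lborel)"
      using K0 by (simp add: ennreal_mult [symmetric] ennreal_leI)
    also have "ennreal (\<integral>y. (f y)\<^sup>2 * \<bar>k (x - y)\<bar> \<partial>lborel) = J x"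
      unfolding J_def using int by (intro nn_integral_eq_integral [symmetric]) auto
    finally show "ennreal ((convolve f k x)\<^sup>2) \<le> ennreal K * J x" .
  qed
  have "(\<integral>\<^sup>+x. ennreal ((convolve f k x)\<^sup>2) \<partial>lborel) \<le> (\<integral>\<^sup>+x. ennreal K * J x \<partial>lborel)"
    using le by (rule nn_integral_mono_AE)
  also have "\<dots> = ennreal K * (\<integral>\<^sup>+x. J x \<partial>lborel)"
    by (rule nn_integral_cmult) measurable
  also have "\<dots> < \<infinity>"
    using J_fin by (simp add: ennreal_mult_less_top)
  finally have "integrable lborel (\<lambda>x. (convolve f k x)\<^sup>2)"
    by (intro integrableI_nonneg) auto
  then show ?thesis
    by (simp add: square_integrable_def)
qed

lift_definition conv_Phi :: "real \<Rightarrow> real \<Rightarrow> int \<Rightarrow> 'n::finite L2 \<Rightarrow> 'n L2"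
  is "\<lambda>r \<sigma>\<^sub>0 j u. convolve u (Phi r \<sigma>\<^sub>0 j)"
proof -
  fix r \<sigma>\<^sub>0 :: real and j :: int and f g :: "real ^ 'n \<Rightarrow> real"
  assume fg: "L2_eq f g"
  have "convolve f (Phi r \<sigma>\<^sub>0 j) x = convolve g (Phi r \<sigma>\<^sub>0 j) x" for x
    unfolding convolve_def
  proof (rule integral_cong_AE)
    have "Phi r \<sigma>\<^sub>0 j \<in> borel_measurable (borel :: (real ^ 'n) measure)"
      using integrable_Phi[of r \<sigma>\<^sub>0 j, where 'a='n] by auto
    note [measurable] = this
    show "(\<lambda>y. f y * Phi r \<sigma>\<^sub>0 j (x - y)) \<in> borel_measurable lborel"
      "(\<lambda>y. g y * Phi r \<sigma>\<^sub>0 j (x - y)) \<in> borel_measurable lborel"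
      using fg by (auto simp: L2_eq_def dest!: square_integrable_measurable)
    show "AE y in lborel. f y * Phi r \<sigma>\<^sub>0 j (x - y) = g y * Phi r \<sigma>\<^sub>0 j (x - y)"
      using fg by (auto simp: L2_eq_def)
  qed
  with fg show "L2_eq (convolve f (Phi r \<sigma>\<^sub>0 j)) (convolve g (Phi r \<sigma>\<^sub>0 j))"
    by (auto simp: L2_eq_def intro: square_integrable_convolve integrable_Phi)
qed


section \<open>The texture space\<close>

definition texture_space :: "real \<Rightarrow> real \<Rightarrow> real \<Rightarrow> 'n::finite L2 set" where
  "texture_space r \<sigma>\<^sub>0 s =
     {u. (\<lambda>j :: int. r powr (2 * of_int j * s) * (norm (conv_Phi r \<sigma>\<^sub>0 j u))\<^sup>2) summable_on UNIV}"

text \<open>Outside the texture space the sum below need not converge and then has the value \<open>0\<close>.\<close>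

definition texture_inner :: "real \<Rightarrow> real \<Rightarrow> real \<Rightarrow> 'n::finite L2 \<Rightarrow> 'n L2 \<Rightarrow> real" where
  "texture_inner r \<sigma>\<^sub>0 s u v =
     u \<bullet> v + (\<Sum>\<^sub>\<infinity>j :: int. r powr (2 * of_int j * s) * (conv_Phi r \<sigma>\<^sub>0 j u \<bullet> conv_Phi r \<sigma>\<^sub>0 j v))"

text \<open>Completeness is with respect to the norm induced by \<open>ip\<close>, not the norm of the ambient type.\<close>

definition hilbert_space_on :: "'v::real_vector set \<Rightarrow> ('v \<Rightarrow> 'v \<Rightarrow> real) \<Rightarrow> bool" where
  "hilbert_space_on V ip \<longleftrightarrow>
     subspace V \<and>
     (\<forall>u\<in>V. \<forall>v\<in>V. ip u v = ip v u) \<and>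
     (\<forall>u\<in>V. \<forall>v\<in>V. \<forall>w\<in>V. ip (u + v) w = ip u w + ip v w) \<and>
     (\<forall>c. \<forall>u\<in>V. \<forall>v\<in>V. ip (c *\<^sub>R u) v = c * ip u v) \<and>
     (\<forall>u\<in>V. 0 \<le> ip u u) \<and>
     (\<forall>u\<in>V. ip u u = 0 \<longrightarrow> u = 0) \<and>
     (\<forall>X :: nat \<Rightarrow> 'v. range X \<subseteq> V \<longrightarrow>
        (\<forall>e>0. \<exists>N. \<forall>m\<ge>N. \<forall>n\<ge>N. sqrt (ip (X m - X n) (X m - X n)) < e) \<longrightarrow>
        (\<exists>u\<in>V. (\<lambda>n. sqrt (ip (X n - u) (X n - u))) \<longlonglongrightarrow> 0))"

end

theory Submission
  imports Defs
begin

text \<open>By Young's inequality every \<open>u \<mapsto> u * \<Phi>\<^sub>j\<close> is a bounded operator on the complete space \<open>L\<^sup>2\<close>.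
  A sequence that is Cauchy for the texture norm therefore has an \<open>L\<^sup>2\<close> limit, along which every
  finite partial sum of the texture norm converges; the Cauchy bounds on the partial sums pass to
  the limit, and taking the supremum over all partial sums gives convergence in the texture norm.\<close>

section \<open>Completeness of the space of square-integrable functions\<close>

lemma square_integrable_diff:
  assumes "square_integrable f" "square_integrable g"
  shows "square_integrable (\<lambda>x. f x - g x)"
  using square_integrable_add[OF assms(1) square_integrable_scale[OF assms(2), of "-1"]] by simp

lemma L2_eq_refl_iff [simp]: "L2_eq f f \<longleftrightarrow> square_integrable f"
  by (auto simp: L2_eq_def)

lemma abs_L2_eqI:
  assumes "square_integrable f" "square_integrable g" "AE x in lborel. f x = g x"
  shows "abs_L2 f = abs_L2 g"
  using assms by (intro Quotient_rel_abs[OF Quotient_L2]) (simp add: L2_eq_def)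

lemma L2_cases:
  obtains f where "square_integrable f" "u = abs_L2 f"
  by (induction u rule: L2.abs_induct) auto

lemma abs_L2_diff:
  assumes "square_integrable f" "square_integrable g"
  shows "abs_L2 f - abs_L2 g = abs_L2 (\<lambda>x. f x - g x)"
proof -
  have "square_integrable (\<lambda>x. - g x)"
    using square_integrable_scale[OF assms(2), of "-1"] by simp
  moreover have "- abs_L2 g = abs_L2 (\<lambda>x. - g x)"
    unfolding uminus_L2_def using assms(2) by (subst scaleR_L2.abs_eq) simp_all
  ultimately show ?thesis
    using assms(1) by (simp add: minus_L2_def plus_L2.abs_eq)
qed

text \<open>Writing the squared norm as a nonnegative extended integral lets Fatou's lemma and
  Tonelli's theorem be used before any integrability is known.\<close>

lemma norm_abs_L2:
  assumes "square_integrable f"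
  shows "ennreal ((norm (abs_L2 f))\<^sup>2) = (\<integral>\<^sup>+x. ennreal ((f x)\<^sup>2) \<partial>lborel)"
proof -
  have "(norm (abs_L2 f))\<^sup>2 = (\<integral>x. (f x)\<^sup>2 \<partial>lborel)"
    using assms unfolding power2_norm_eq_inner by (simp add: inner_L2.abs_eq power2_eq_square)
  then show ?thesis
    using assms by (simp add: square_integrable_def nn_integral_eq_integral)
qed

lemma square_integrableI:
  assumes "f \<in> borel_measurable borel" "(\<integral>\<^sup>+x. ennreal ((f x)\<^sup>2) \<partial>lborel) < \<infinity>"
  shows "square_integrable f"
  using assms by (auto simp: square_integrable_def intro!: integrableI_nonneg)

lemma Cauchy_fast_subseq:
  fixes X :: "nat \<Rightarrow> 'a::metric_space" and e :: "nat \<Rightarrow> real"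
  assumes "Cauchy X" "\<And>i. 0 < e i"
  obtains \<phi> where "strict_mono \<phi>" "\<And>i m n. \<phi> i \<le> m \<Longrightarrow> \<phi> i \<le> n \<Longrightarrow> dist (X m) (X n) < e i"
proof -
  define P where "P i N \<longleftrightarrow> (\<forall>m\<ge>N. \<forall>n\<ge>N. dist (X m) (X n) < e i)" for i N :: nat
  have ex: "\<exists>N. P i N" for i
    using assms by (simp add: P_def Cauchy_def)
  have "\<exists>M. P (Suc i) M \<and> N < M" for i N
  proof -
    obtain M where "P (Suc i) M"
      using ex by blast
    \<comment> \<open>\<open>P\<close> survives enlarging the threshold, so strict growth of the
      chosen indices can be forced.\<close>
    then have "P (Suc i) (max M (Suc N))"
      by (simp add: P_def)
    then show ?thesis
      by (meson lessI less_le_trans max.cobounded2)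
  qed
  then obtain \<phi> where "\<And>i. P i (\<phi> i)" "\<And>i. \<phi> i < \<phi> (Suc i)"
    using dependent_nat_choice[of P "\<lambda>_ N M. N < M"] ex by blast
  then show ?thesis
    using that[of \<phi>] by (simp add: P_def strict_mono_Suc_iff)
qed

text \<open>Riesz-Fischer: a rapidly converging subsequence converges almost everywhere because its
  increments are absolutely summable there. Fatou's lemma turns the pointwise limit into a limit in
  norm, and a Cauchy sequence follows its convergent subsequence.\<close>

instance L2 :: (finite) complete_space
proof
  fix X :: "nat \<Rightarrow> 'a L2"
  assume X: "Cauchy X"
  obtain \<phi> where \<phi>: "strict_mono \<phi>"
    "\<And>i m n. \<phi> i \<le> m \<Longrightarrow> \<phi> i \<le> n \<Longrightarrow> dist (X m) (X n) < (1 / 2) ^ i"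
    using Cauchy_fast_subseq[OF X, of "\<lambda>i. (1 / 2) ^ i"] by auto
  have "\<exists>f. square_integrable f \<and> X (\<phi> i) = abs_L2 f" for i
    by (meson L2_cases)
  then obtain f where f: "\<And>i. square_integrable (f i)" "\<And>i. X (\<phi> i) = abs_L2 (f i)"
    by metis
  have f_meas [measurable]: "f i \<in> borel_measurable borel" for i
    using f by (simp add: square_integrable_def)
  have le: "(\<integral>\<^sup>+x. ennreal ((f m x - f n x)\<^sup>2) \<partial>lborel) \<le> ennreal ((1 / 4) ^ i)"
    if "i \<le> m" "i \<le> n" for i m n
  proof -
    have "\<phi> i \<le> \<phi> m" "\<phi> i \<le> \<phi> n"
      using that \<phi>(1) by (simp_all add: strict_mono_less_eq)
    then have "norm (abs_L2 (\<lambda>x. f m x - f n x)) < (1 / 2) ^ i"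
      using \<phi>(2)[of i "\<phi> m" "\<phi> n"] by (simp add: f dist_norm abs_L2_diff)
    then have "(norm (abs_L2 (\<lambda>x. f m x - f n x)))\<^sup>2 \<le> ((1 / 2) ^ i)\<^sup>2"
      by (intro power_mono) auto
    also have "\<dots> = (1 / 4) ^ i"
      by (simp add: power2_eq_square power_mult_distrib [symmetric])
    finally show ?thesis
      using norm_abs_L2[OF square_integrable_diff[OF f(1)[of m] f(1)[of n]]] by (metis ennreal_leI)
  qed
  define d where "d i x = f (Suc i) x - f i x" for i x
  have d_meas [measurable]: "d i \<in> borel_measurable borel" for i
    by (simp add: d_def [abs_def])
  \<comment> \<open>Since \<open>|d\<^sub>i| \<le> 2\<^sup>-\<^sup>i + 2\<^sup>i d\<^sub>i\<^sup>2\<close>, finiteness of this weighted sum makes \<open>\<Sum>|d\<^sub>i|\<close> finite almost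
    everywhere without an appeal to Minkowski's inequality.\<close>
  have "(\<integral>\<^sup>+x. (\<Sum>i. ennreal (2 ^ i * (d i x)\<^sup>2)) \<partial>lborel)
      = (\<Sum>i. \<integral>\<^sup>+x. ennreal (2 ^ i * (d i x)\<^sup>2) \<partial>lborel)"
    by (rule nn_integral_suminf) measurable
  also have "\<dots> \<le> (\<Sum>i. ennreal ((1 / 2) ^ i))"
  \<comment> \<open>The weight \<open>2 ^ i\<close> loses against the decay
    \<open>(1 / 4) ^ i\<close> of the squared distances, which leaves a geometric series.\<close>
  proof (rule suminf_le)
    fix i
    have "(\<integral>\<^sup>+x. ennreal (2 ^ i * (d i x)\<^sup>2) \<partial>lborel)
        = ennreal (2 ^ i) * (\<integral>\<^sup>+x. ennreal ((d i x)\<^sup>2) \<partial>lborel)"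
      by (simp add: ennreal_mult nn_integral_cmult)
    also have "\<dots> \<le> ennreal (2 ^ i) * ennreal ((1 / 4) ^ i)"
      unfolding d_def by (intro mult_left_mono le) auto
    also have "\<dots> = ennreal ((1 / 2) ^ i)"
      by (simp add: ennreal_mult [symmetric] power_mult_distrib [symmetric] del: ennreal_power)
    finally show "(\<integral>\<^sup>+x. ennreal (2 ^ i * (d i x)\<^sup>2) \<partial>lborel) \<le> ennreal ((1 / 2) ^ i)" .
  qed auto
  also have "\<dots> < \<infinity>"
    by (subst suminf_ennreal2) (auto intro: summable_geometric)
  finally have "AE x in lborel. (\<Sum>i. ennreal (2 ^ i * (d i x)\<^sup>2)) \<noteq> \<infinity>"
    by (intro nn_integral_PInf_AE) auto
  then have conv: "AE x in lborel. (\<lambda>i. f i x) \<longlonglongrightarrow> lim (\<lambda>i. f i x)"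
  proof eventually_elim
    fix x
    assume "(\<Sum>i. ennreal (2 ^ i * (d i x)\<^sup>2)) \<noteq> \<infinity>"
    then have "summable (\<lambda>i. 2 ^ i * (d i x)\<^sup>2)"
      by (intro summable_suminf_not_top) auto
    then have "summable (\<lambda>i. (1 / 2) ^ i + 2 ^ i * (d i x)\<^sup>2)"
      by (intro summable_add summable_geometric) auto
    moreover have "norm (d i x) \<le> (1 / 2) ^ i + 2 ^ i * (d i x)\<^sup>2" for i
    proof -
      define t :: real where "t = 2 ^ i"
      have "t > 0"
        by (simp add: t_def)
      \<comment> \<open>The arithmetic-geometric inequality for 1 and
        \<open>t * \<bar>d i x\<bar>\<close>; dividing by \<open>t\<close> afterwards yields the
        summable bound.\<close>
      have "2 * (t * \<bar>d i x\<bar>) \<le> 1 + (t * \<bar>d i x\<bar>)\<^sup>2" "0 \<le> t * \<bar>d i x\<bar>"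
        using sum_squares_bound[of 1 "t * \<bar>d i x\<bar>"] \<open>t > 0\<close> by simp_all
      then have "t * \<bar>d i x\<bar> \<le> 1 + (t * \<bar>d i x\<bar>)\<^sup>2"
        by linarith
      also have "\<dots> = t * (1 / t + t * (d i x)\<^sup>2)"
        using \<open>t > 0\<close> by (simp add: distrib_left power_mult_distrib power2_eq_square)
      finally have "t * \<bar>d i x\<bar> \<le> t * (1 / t + t * (d i x)\<^sup>2)" .
      then show ?thesis
        using \<open>t > 0\<close> by (simp add: t_def power_divide)
    qed
    ultimately have "summable (\<lambda>i. d i x)"
      by (rule summable_comparison_test'[where N = 0])
    then have "convergent (\<lambda>n. \<Sum>i<n. d i x)"
      by (simp add: summable_iff_convergent)
    \<comment> \<open>The increments telescope, so adding the initial term recovers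
      \<open>f n x\<close>.\<close>
    then have "convergent (\<lambda>n. (\<Sum>i<n. d i x) + f 0 x)"
      by (intro convergent_add convergent_const)
    moreover have "(\<lambda>n. (\<Sum>i<n. d i x) + f 0 x) = (\<lambda>n. f n x)"
      unfolding d_def by (simp add: sum_lessThan_telescope[of "\<lambda>i. f i x" for x])
    ultimately show "(\<lambda>i. f i x) \<longlonglongrightarrow> lim (\<lambda>i. f i x)"
      by (simp add: convergent_LIMSEQ_iff)
  qed
  \<comment> \<open>On the null set where the sequence diverges, \<open>lim\<close> is an
    unspecified value; \<open>g\<close> is still Borel measurable.\<close>
  define g where "g x = lim (\<lambda>i. f i x)" for x
  have g_meas [measurable]: "g \<in> borel_measurable borel"
    unfolding g_def [abs_def] by measurable
  \<comment> \<open>Fix \<open>m\<close> and let \<open>n\<close> tend to infinity in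
    \<open>le\<close>, taken with \<open>i = m\<close>.\<close>
  have fatou: "(\<integral>\<^sup>+x. ennreal ((f m x - g x)\<^sup>2) \<partial>lborel) \<le> ennreal ((1 / 4) ^ m)" for m
  proof -
    have "AE x in lborel. ennreal ((f m x - g x)\<^sup>2) = liminf (\<lambda>n. ennreal ((f m x - f n x)\<^sup>2))"
      using conv
    proof eventually_elim
      fix x
      assume "(\<lambda>i. f i x) \<longlonglongrightarrow> lim (\<lambda>i. f i x)"
      then have "(\<lambda>n. ennreal ((f m x - f n x)\<^sup>2)) \<longlonglongrightarrow> ennreal ((f m x - g x)\<^sup>2)"
        unfolding g_def by (intro tendsto_intros)
      then show "ennreal ((f m x - g x)\<^sup>2) = liminf (\<lambda>n. ennreal ((f m x - f n x)\<^sup>2))"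
        by (rule lim_imp_Liminf[symmetric, OF sequentially_bot])
    qed
    then have "(\<integral>\<^sup>+x. ennreal ((f m x - g x)\<^sup>2) \<partial>lborel)
        = (\<integral>\<^sup>+x. liminf (\<lambda>n. ennreal ((f m x - f n x)\<^sup>2)) \<partial>lborel)"
      by (rule nn_integral_cong_AE)
    also have "\<dots> \<le> liminf (\<lambda>n. \<integral>\<^sup>+x. ennreal ((f m x - f n x)\<^sup>2) \<partial>lborel)"
      by (rule nn_integral_liminf) measurable
    also have "\<dots> \<le> ennreal ((1 / 4) ^ m)"
    proof (rule order_trans[OF Liminf_le_Limsup Limsup_bounded])
      show "\<forall>\<^sub>F n in sequentially. (\<integral>\<^sup>+x. ennreal ((f m x - f n x)\<^sup>2) \<partial>lborel) \<le> ennreal ((1 / 4) ^ m)"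
        using eventually_ge_at_top[of m] by eventually_elim (rule le, auto)
    qed simp
    finally show ?thesis .
  qed
  have diff: "square_integrable (\<lambda>x. f m x - g x)" for m
    using fatou[of m] by (intro square_integrableI) (auto intro: le_less_trans)
  \<comment> \<open>\<open>g\<close> is recovered as \<open>f 0 - (f 0 - g)\<close>.\<close>
  have g: "square_integrable g"
    using square_integrable_diff[OF f(1)[of 0] diff[of 0]] by simp
  have "dist (X (\<phi> m)) (abs_L2 g) \<le> (1 / 2) ^ m" for m
  proof -
    have "ennreal ((norm (X (\<phi> m) - abs_L2 g))\<^sup>2) \<le> ennreal ((1 / 4) ^ m)"
      using fatou[of m] f g diff by (simp add: abs_L2_diff norm_abs_L2)
    then have "(norm (X (\<phi> m) - abs_L2 g))\<^sup>2 \<le> (1 / 4) ^ m"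
      by (simp del: ennreal_power)
    also have "\<dots> = ((1 / 2) ^ m)\<^sup>2"
      by (simp add: power2_eq_square power_mult_distrib [symmetric])
    finally show ?thesis
      by (auto simp: dist_norm intro: power2_le_imp_le)
  qed
  then have "(\<lambda>m. dist ((X \<circ> \<phi>) m) (abs_L2 g)) \<longlonglongrightarrow> 0"
    by (intro tendsto_sandwich[OF _ _ tendsto_const LIMSEQ_power_zero[of "1 / 2 :: real"]]) auto
  then have "(X \<circ> \<phi>) \<longlonglongrightarrow> abs_L2 g"
    by (rule tendsto_dist_iff[THEN iffD2])
  then show "convergent X"
    using Cauchy_converges_subseq[OF X \<phi>(1)] by (auto simp: convergent_def)
qed


section \<open>Convolution as a bounded operator\<close>

text \<open>Young's inequality follows from the Cauchy--Schwarz inequality for the splitting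
  \<open>|f| |k| = (|f| |k|\<^sup>1\<^sup>/\<^sup>2) |k|\<^sup>1\<^sup>/\<^sup>2\<close>.\<close>

lemma Young_nn_integral:
  fixes f k :: "real ^ 'n::finite \<Rightarrow> real"
  assumes [measurable]: "f \<in> borel_measurable borel" "k \<in> borel_measurable borel"
  shows "(\<integral>\<^sup>+x. (\<integral>\<^sup>+y. ennreal \<bar>f y * k (x - y)\<bar> \<partial>lborel)\<^sup>2 \<partial>lborel)
    \<le> (\<integral>\<^sup>+y. ennreal \<bar>k y\<bar> \<partial>lborel)\<^sup>2 * (\<integral>\<^sup>+y. ennreal ((f y)\<^sup>2) \<partial>lborel)"
proof -
  define K where "K = (\<integral>\<^sup>+y. ennreal \<bar>k y\<bar> \<partial>lborel)"
  have pointwise: "(\<integral>\<^sup>+y. ennreal \<bar>f y * k (x - y)\<bar> \<partial>lborel)\<^sup>2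
      \<le> (\<integral>\<^sup>+y. ennreal ((f y)\<^sup>2) * ennreal \<bar>k (x - y)\<bar> \<partial>lborel) * K" for x
  proof -
    have "(\<integral>\<^sup>+y. ennreal \<bar>f y * k (x - y)\<bar> \<partial>lborel)\<^sup>2
        = (\<integral>\<^sup>+y. ennreal (\<bar>f y\<bar> * sqrt \<bar>k (x - y)\<bar>) * ennreal (sqrt \<bar>k (x - y)\<bar>) \<partial>lborel)\<^sup>2"
      by (simp add: ennreal_mult [symmetric] mult.assoc abs_mult)
    also have "\<dots> \<le> (\<integral>\<^sup>+y. (ennreal (\<bar>f y\<bar> * sqrt \<bar>k (x - y)\<bar>))\<^sup>2 \<partial>lborel)
        * (\<integral>\<^sup>+y. (ennreal (sqrt \<bar>k (x - y)\<bar>))\<^sup>2 \<partial>lborel)"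
      by (rule Cauchy_Schwarz_nn_integral) measurable
    \<comment> \<open>Lebesgue measure is invariant under the reflection sending \<open>y\<close> to
      \<open>x - y\<close>, so this factor does not depend on \<open>x\<close>.\<close>
    also have "(\<integral>\<^sup>+y. (ennreal (sqrt \<bar>k (x - y)\<bar>))\<^sup>2 \<partial>lborel) = K"
      using nn_integral_lborel_reflect[of "\<lambda>y. ennreal \<bar>k y\<bar>" x] by (simp add: K_def ennreal_power)
    also have "(\<integral>\<^sup>+y. (ennreal (\<bar>f y\<bar> * sqrt \<bar>k (x - y)\<bar>))\<^sup>2 \<partial>lborel)
        = (\<integral>\<^sup>+y. ennreal ((f y)\<^sup>2) * ennreal \<bar>k (x - y)\<bar> \<partial>lborel)"
      by (simp add: ennreal_power power_mult_distrib ennreal_mult)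
    finally show ?thesis .
  qed
  have "(\<integral>\<^sup>+x. (\<integral>\<^sup>+y. ennreal \<bar>f y * k (x - y)\<bar> \<partial>lborel)\<^sup>2 \<partial>lborel)
      \<le> (\<integral>\<^sup>+x. (\<integral>\<^sup>+y. ennreal ((f y)\<^sup>2) * ennreal \<bar>k (x - y)\<bar> \<partial>lborel) * K \<partial>lborel)"
    by (intro nn_integral_mono pointwise)
  also have "\<dots> = (\<integral>\<^sup>+x. (\<integral>\<^sup>+y. ennreal ((f y)\<^sup>2) * ennreal \<bar>k (x - y)\<bar> \<partial>lborel) \<partial>lborel) * K"
    by (rule nn_integral_multc) measurable
  \<comment> \<open>After Tonelli's exchange the inner integral only involves a translate of
    \<open>\<bar>k\<bar>\<close> and contributes a second factor \<open>K\<close>.\<close>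
  also have "(\<integral>\<^sup>+x. (\<integral>\<^sup>+y. ennreal ((f y)\<^sup>2) * ennreal \<bar>k (x - y)\<bar> \<partial>lborel) \<partial>lborel)
      = (\<integral>\<^sup>+y. (\<integral>\<^sup>+x. ennreal ((f y)\<^sup>2) * ennreal \<bar>k (x - y)\<bar> \<partial>lborel) \<partial>lborel)"
    by (rule lborel_pair.Fubini') measurable
  also have "\<dots> = (\<integral>\<^sup>+y. ennreal ((f y)\<^sup>2) * K \<partial>lborel)"
    using nn_integral_lborel_shift[of "\<lambda>y. ennreal \<bar>k y\<bar>"] by (simp add: nn_integral_cmult K_def)
  also have "\<dots> = (\<integral>\<^sup>+y. ennreal ((f y)\<^sup>2) \<partial>lborel) * K"
    by (rule nn_integral_multc) measurable
  finally show ?thesis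
    by (simp add: K_def power2_eq_square ac_simps)
qed

text \<open>The Bochner integral is 0 where the integrand is not integrable, so convolution can be
  split over a sum only at points where both integrals exist. Finiteness of the double integral in
  Young's inequality makes these almost all points.\<close>

lemma AE_integrable_convolve:
  fixes f k :: "real ^ 'n::finite \<Rightarrow> real"
  assumes f: "square_integrable f" and k: "integrable lborel k"
  shows "AE x in lborel. integrable lborel (\<lambda>y. f y * k (x - y))"
proof -
  have [measurable]: "f \<in> borel_measurable borel" "k \<in> borel_measurable borel"
    using f k by (auto simp: square_integrable_def)
  have "(\<integral>\<^sup>+y. ennreal \<bar>k y\<bar> \<partial>lborel)\<^sup>2 * (\<integral>\<^sup>+y. ennreal ((f y)\<^sup>2) \<partial>lborel) < \<infinity>"
    using f k by (auto simp: square_integrable_def integrable_iff_bounded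
        ennreal_mult_less_top power_less_top_ennreal)
  then have "(\<integral>\<^sup>+x. (\<integral>\<^sup>+y. ennreal \<bar>f y * k (x - y)\<bar> \<partial>lborel)\<^sup>2 \<partial>lborel) \<noteq> \<infinity>"
    using Young_nn_integral[of f k] by (auto simp: top_unique)
  then have "AE x in lborel. (\<integral>\<^sup>+y. ennreal \<bar>f y * k (x - y)\<bar> \<partial>lborel)\<^sup>2 \<noteq> \<infinity>"
    by (intro nn_integral_PInf_AE) measurable
  then show ?thesis
  proof eventually_elim
    fix x
    assume "(\<integral>\<^sup>+y. ennreal \<bar>f y * k (x - y)\<bar> \<partial>lborel)\<^sup>2 \<noteq> \<infinity>"
    then show "integrable lborel (\<lambda>y. f y * k (x - y))"
      by (auto simp: integrable_iff_bounded less_top power_less_top_ennreal)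
  qed
qed

lemma norm_abs_L2_convolve_le:
  fixes f k :: "real ^ 'n::finite \<Rightarrow> real"
  assumes f: "square_integrable f" and k: "integrable lborel k"
  shows "norm (abs_L2 (convolve f k)) \<le> norm (abs_L2 f) * (\<integral>y. \<bar>k y\<bar> \<partial>lborel)"
proof -
  define K where "K = (\<integral>y. \<bar>k y\<bar> \<partial>lborel)"
  have "0 \<le> K"
    by (simp add: K_def)
  have [measurable]: "f \<in> borel_measurable borel" "k \<in> borel_measurable borel"
    using f k by (auto simp: square_integrable_def)
  have "ennreal ((norm (abs_L2 (convolve f k)))\<^sup>2) = (\<integral>\<^sup>+x. ennreal ((convolve f k x)\<^sup>2) \<partial>lborel)"
    using f k by (intro norm_abs_L2 square_integrable_convolve)
  also have "\<dots> \<le> (\<integral>\<^sup>+x. (\<integral>\<^sup>+y. ennreal \<bar>f y * k (x - y)\<bar> \<partial>lborel)\<^sup>2 \<partial>lborel)"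
  proof (rule nn_integral_mono)
    fix x
    have "ennreal \<bar>convolve f k x\<bar> \<le> (\<integral>\<^sup>+y. ennreal \<bar>f y * k (x - y)\<bar> \<partial>lborel)"
    \<comment> \<open>If the integrand is not integrable, \<open>convolve f k x\<close> has the
      default value 0 and the bound is trivial.\<close>
    proof (cases "integrable lborel (\<lambda>y. f y * k (x - y))")
      case True
      then show ?thesis
        using integral_norm_bound_ennreal[OF True] by (simp add: convolve_def)
    qed (simp add: convolve_def not_integrable_integral_eq)
    then have "(ennreal \<bar>convolve f k x\<bar>)\<^sup>2 \<le> (\<integral>\<^sup>+y. ennreal \<bar>f y * k (x - y)\<bar> \<partial>lborel)\<^sup>2"
      by (rule power_mono) simp
    then show "ennreal ((convolve f k x)\<^sup>2) \<le> (\<integral>\<^sup>+y. ennreal \<bar>f y * k (x - y)\<bar> \<partial>lborel)\<^sup>2"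
      by (simp add: ennreal_power)
  qed
  also have "\<dots> \<le> (\<integral>\<^sup>+y. ennreal \<bar>k y\<bar> \<partial>lborel)\<^sup>2 * (\<integral>\<^sup>+y. ennreal ((f y)\<^sup>2) \<partial>lborel)"
    by (rule Young_nn_integral) measurable
  also have "(\<integral>\<^sup>+y. ennreal \<bar>k y\<bar> \<partial>lborel) = ennreal K"
    unfolding K_def using k by (intro nn_integral_eq_integral) auto
  also have "(ennreal K)\<^sup>2 * (\<integral>\<^sup>+y. ennreal ((f y)\<^sup>2) \<partial>lborel) = ennreal ((norm (abs_L2 f) * K)\<^sup>2)"
    using \<open>0 \<le> K\<close> by (simp add: norm_abs_L2 [OF f, symmetric] ennreal_power ennreal_mult
        power_mult_distrib mult.commute)
  finally have "(norm (abs_L2 (convolve f k)))\<^sup>2 \<le> (norm (abs_L2 f) * K)\<^sup>2"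
    by simp
  then show ?thesis
    unfolding K_def [symmetric] by (rule power2_le_imp_le) (simp add: \<open>0 \<le> K\<close>)
qed

text \<open>The operator bound is the \<open>L1\<close> norm of the kernel. Additivity of the
  convolution is available almost everywhere, which suffices for equality of classes, while
  homogeneity holds at every point.\<close>

lemma bounded_linear_conv_Phi: "bounded_linear (conv_Phi r \<sigma>\<^sub>0 j :: 'n::finite L2 \<Rightarrow> 'n L2)"
proof (rule bounded_linear_intro)
  let ?k = "Phi r \<sigma>\<^sub>0 j :: real ^ 'n \<Rightarrow> real"
  note k = integrable_Phi[of r \<sigma>\<^sub>0 j, where 'a='n]
  fix u v :: "'n L2" and c :: real
  obtain f where f: "square_integrable f" "u = abs_L2 f"
    by (rule L2_cases)
  obtain g where g: "square_integrable g" "v = abs_L2 g"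
    by (rule L2_cases)
  have "AE x in lborel. convolve (\<lambda>x. f x + g x) ?k x = convolve f ?k x + convolve g ?k x"
    using AE_integrable_convolve[OF f(1) k] AE_integrable_convolve[OF g(1) k]
    by eventually_elim (simp add: convolve_def distrib_right)
  moreover have fg: "square_integrable (\<lambda>x. f x + g x)"
    using f g by (simp add: square_integrable_add)
  ultimately have "abs_L2 (convolve (\<lambda>x. f x + g x) ?k)
      = abs_L2 (\<lambda>x. convolve f ?k x + convolve g ?k x)"
    using f g k by (intro abs_L2_eqI square_integrable_add square_integrable_convolve)
  then show "conv_Phi r \<sigma>\<^sub>0 j (u + v) = conv_Phi r \<sigma>\<^sub>0 j u + conv_Phi r \<sigma>\<^sub>0 j v"
    using f g k fg square_integrable_convolve[OF f(1) k] square_integrable_convolve[OF g(1) k]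
    by (simp add: plus_L2.abs_eq conv_Phi.abs_eq)
  have "convolve (\<lambda>x. c * f x) ?k = (\<lambda>x. c * convolve f ?k x)"
    by (simp add: convolve_def [abs_def] mult.assoc)
  then show "conv_Phi r \<sigma>\<^sub>0 j (c *\<^sub>R u) = c *\<^sub>R conv_Phi r \<sigma>\<^sub>0 j u"
    using f k square_integrable_scale[OF f(1), of c] square_integrable_convolve[OF f(1) k]
    by (simp add: scaleR_L2.abs_eq conv_Phi.abs_eq)
  show "norm (conv_Phi r \<sigma>\<^sub>0 j u) \<le> norm u * (\<integral>y. \<bar>?k y\<bar> \<partial>lborel)"
    using norm_abs_L2_convolve_le[OF f(1) k] f by (simp add: conv_Phi.abs_eq)
qed


section \<open>Weighted graph norms of families of bounded operators\<close>

text \<open>The abstract setting isolates what the texture norm uses of convolution: each operator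
  is bounded, with a bound that may depend on the index.\<close>

locale weighted_operators =
  fixes T :: "'i \<Rightarrow> 'a::{real_inner, complete_space} \<Rightarrow> 'b::real_inner"
    and w :: "'i \<Rightarrow> real"
  assumes bounded_linear_T: "\<And>j. bounded_linear (T j)"
    and w_nonneg: "\<And>j. 0 \<le> w j"
begin

definition dom_space :: "'a set" where
  "dom_space = {u. (\<lambda>j. w j * (norm (T j u))\<^sup>2) summable_on UNIV}"

text \<open>The induced norm is the graph norm of the map taking \<open>u\<close> to the family
  \<open>sqrt (w j) *\<^sub>R T j u\<close> in the square-summable direct sum of copies of
  \<open>'b\<close>.\<close>

definition graph_inner :: "'a \<Rightarrow> 'a \<Rightarrow> real" where
  "graph_inner u v = u \<bullet> v + (\<Sum>\<^sub>\<infinity>j. w j * (T j u \<bullet> T j v))"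

lemma linear_T: "linear (T j)"
  using bounded_linear_T by (rule bounded_linear.linear)

text \<open>By Cauchy-Schwarz and \<open>a * b \<le> a\<^sup>2 + b\<^sup>2\<close> for nonnegative
  reals, the mixed series is dominated by the two series that define membership.\<close>

lemma summable_inner:
  assumes "u \<in> dom_space" "v \<in> dom_space"
  shows "(\<lambda>j. w j * (T j u \<bullet> T j v)) summable_on UNIV"
proof (rule abs_summable_summable, rule summable_on_comparison_test)
  show "(\<lambda>j. w j * (norm (T j u))\<^sup>2 + w j * (norm (T j v))\<^sup>2) summable_on UNIV"
    using assms by (intro summable_on_add) (simp_all add: dom_space_def)
  fix j
  have "\<bar>T j u \<bullet> T j v\<bar> \<le> norm (T j u) * norm (T j v)"
    by (rule Cauchy_Schwarz_ineq2)
  also have "\<dots> \<le> (norm (T j u))\<^sup>2 + (norm (T j v))\<^sup>2"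
    using sum_squares_bound[of "norm (T j u)" "norm (T j v)"]
      mult_nonneg_nonneg[OF norm_ge_zero[of "T j u"] norm_ge_zero[of "T j v"]] by linarith
  finally show "norm (w j * (T j u \<bullet> T j v)) \<le> w j * (norm (T j u))\<^sup>2 + w j * (norm (T j v))\<^sup>2"
    using w_nonneg[of j] by (simp add: abs_mult distrib_left [symmetric] mult_left_mono)
qed simp

lemma subspace_dom_space: "subspace dom_space"
proof (rule subspaceI)
  show "0 \<in> dom_space"
    by (simp add: dom_space_def linear_0[OF linear_T])
next
  fix u v
  assume uv: "u \<in> dom_space" "v \<in> dom_space"
  \<comment> \<open>This is the expanded square of \<open>T j (u + v)\<close>; its cross term is
    covered by \<open>summable_inner\<close>.\<close>
  then have "(\<lambda>j. w j * (norm (T j u))\<^sup>2 + w j * (norm (T j v))\<^sup>2 + 2 * (w j * (T j u \<bullet> T j v)))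
      summable_on UNIV"
    by (intro summable_on_add summable_on_cmult_right summable_inner) (simp_all add: dom_space_def)
  moreover have "w j * (norm (T j u))\<^sup>2 + w j * (norm (T j v))\<^sup>2 + 2 * (w j * (T j u \<bullet> T j v))
      = w j * (norm (T j (u + v)))\<^sup>2" for j
    by (simp add: linear_add[OF linear_T] power2_norm_eq_inner inner_add inner_commute algebra_simps)
  ultimately show "u + v \<in> dom_space"
    by (simp add: dom_space_def)
next
  fix c u
  assume "u \<in> dom_space"
  then have "(\<lambda>j. c\<^sup>2 * (w j * (norm (T j u))\<^sup>2)) summable_on UNIV"
    by (intro summable_on_cmult_right) (simp add: dom_space_def)
  then show "c *\<^sub>R u \<in> dom_space"
    by (simp add: dom_space_def linear_scale[OF linear_T] power_mult_distrib mult.left_commute)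
qed

lemma graph_inner_same: "graph_inner u u = (norm u)\<^sup>2 + (\<Sum>\<^sub>\<infinity>j. w j * (norm (T j u))\<^sup>2)"
  by (simp add: graph_inner_def power2_norm_eq_inner)

text \<open>The infinite sum is nonnegative, also off \<open>dom_space\<close>, where it defaults to
  0. This gives definiteness and makes sequences that are Cauchy for the graph norm Cauchy in
  \<open>'a\<close>.\<close>

lemma norm_le_graph_inner: "(norm u)\<^sup>2 \<le> graph_inner u u"
  by (simp add: graph_inner_same infsum_nonneg w_nonneg)

lemma finite_sum_le_graph_inner:
  assumes "u \<in> dom_space" "finite F"
  shows "(norm u)\<^sup>2 + (\<Sum>j\<in>F. w j * (norm (T j u))\<^sup>2) \<le> graph_inner u u"
  unfolding graph_inner_same using assms w_nonneg
  by (intro add_left_mono finite_sum_le_infsum) (auto simp: dom_space_def)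

text \<open>A series of nonnegative terms converges once its finite partial sums are bounded, and
  its value is their supremum. Bounds can thus be proved on finite sums, through which limits pass
  freely.\<close>

lemma dom_spaceI_finite_sums:
  assumes le: "\<And>F. finite F \<Longrightarrow> (norm u)\<^sup>2 + (\<Sum>j\<in>F. w j * (norm (T j u))\<^sup>2) \<le> B"
  shows "u \<in> dom_space" "graph_inner u u \<le> B"
proof -
  have le': "(\<Sum>j\<in>F. w j * (norm (T j u))\<^sup>2) \<le> B - (norm u)\<^sup>2" if "finite F" for F
    using le[OF that] by simp
  have sm: "(\<lambda>j. w j * (norm (T j u))\<^sup>2) summable_on UNIV"
    by (rule nonneg_bdd_above_summable_on) (auto intro!: bdd_aboveI le' simp: w_nonneg)
  then show "u \<in> dom_space"
    by (simp add: dom_space_def)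
  show "graph_inner u u \<le> B"
    using infsum_le_finite_sums[OF sm le'] by (simp add: graph_inner_same)
qed

lemma complete_graph_inner:
  assumes X: "range X \<subseteq> dom_space"
    and Cauchy: "\<And>e. e > 0 \<Longrightarrow>
      \<exists>N. \<forall>m\<ge>N. \<forall>n\<ge>N. sqrt (graph_inner (X m - X n) (X m - X n)) < e"
  obtains u where "u \<in> dom_space" "(\<lambda>n. sqrt (graph_inner (X n - u) (X n - u))) \<longlonglongrightarrow> 0"
proof -
  have norm_le: "norm v \<le> sqrt (graph_inner v v)" for v
    using norm_le_graph_inner by (rule real_le_rsqrt)
  have "Cauchy X"
    unfolding Cauchy_def dist_norm using Cauchy norm_le[THEN le_less_trans] by fast
  then obtain u where u: "X \<longlonglongrightarrow> u"
    using Cauchy_convergent by (auto simp: convergent_def)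
  have Xm: "X m \<in> dom_space" for m
    using X by auto
  have close: "\<exists>N. \<forall>m\<ge>N. X m - u \<in> dom_space \<and> graph_inner (X m - u) (X m - u) \<le> e\<^sup>2"
    if e: "e > 0" for e
  proof -
    obtain N where N: "\<And>m n. m \<ge> N \<Longrightarrow> n \<ge> N \<Longrightarrow> sqrt (graph_inner (X m - X n) (X m - X n)) < e"
      using Cauchy[OF e] by blast
    \<comment> \<open>For fixed \<open>m\<close> and \<open>F\<close> let \<open>n\<close> tend to
      infinity; each \<open>T j\<close> is continuous and \<open>F\<close> is finite. Since
      \<open>N\<close> was chosen before \<open>F\<close>, the bound is uniform in
      \<open>F\<close>.\<close>
    have "(norm (X m - u))\<^sup>2 + (\<Sum>j\<in>F. w j * (norm (T j (X m - u)))\<^sup>2) \<le> e\<^sup>2"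
      if "m \<ge> N" "finite F" for m F
    proof (rule LIMSEQ_le_const2)
      show "(\<lambda>n. (norm (X m - X n))\<^sup>2 + (\<Sum>j\<in>F. w j * (norm (T j (X m - X n)))\<^sup>2))
          \<longlonglongrightarrow> (norm (X m - u))\<^sup>2 + (\<Sum>j\<in>F. w j * (norm (T j (X m - u)))\<^sup>2)"
        by (intro tendsto_intros u bounded_linear.tendsto[OF bounded_linear_T])
      have "(norm (X m - X n))\<^sup>2 + (\<Sum>j\<in>F. w j * (norm (T j (X m - X n)))\<^sup>2) \<le> e\<^sup>2" if "n \<ge> N" for n
      proof -
        have "X m - X n \<in> dom_space"
          using subspace_dom_space Xm by (intro subspace_diff)
        then have "(norm (X m - X n))\<^sup>2 + (\<Sum>j\<in>F. w j * (norm (T j (X m - X n)))\<^sup>2)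
            \<le> graph_inner (X m - X n) (X m - X n)"
          using \<open>finite F\<close> by (rule finite_sum_le_graph_inner)
        also have "\<dots> \<le> e\<^sup>2"
          using N[OF \<open>m \<ge> N\<close> that] by (rule sqrt_le_D[OF less_imp_le])
        finally show ?thesis .
      qed
      then show "\<exists>N. \<forall>n\<ge>N. (norm (X m - X n))\<^sup>2 + (\<Sum>j\<in>F. w j * (norm (T j (X m - X n)))\<^sup>2) \<le> e\<^sup>2"
        by blast
    qed
    then show ?thesis
      using dom_spaceI_finite_sums by blast
  qed
  obtain m where m: "X m - u \<in> dom_space"
    using close[of 1] by auto
  \<comment> \<open>This difference equals \<open>u\<close>, so the limit inherits membership from
    the subspace property.\<close>
  have "X m - (X m - u) \<in> dom_space"
    using subspace_dom_space Xm m by (rule subspace_diff)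
  then have "u \<in> dom_space"
    by simp
  moreover have "(\<lambda>n. sqrt (graph_inner (X n - u) (X n - u))) \<longlonglongrightarrow> 0"
  proof (rule LIMSEQ_I)
    fix e :: real
    assume "e > 0"
    then obtain N where N: "\<forall>m\<ge>N. graph_inner (X m - u) (X m - u) \<le> (e / 2)\<^sup>2"
      \<comment> \<open>Halving \<open>e\<close> turns the non-strict bound of \<open>close\<close>
        into a strict one.\<close>
      using close[of "e / 2"] by auto
    have "norm (sqrt (graph_inner (X m - u) (X m - u)) - 0) < e" if "m \<ge> N" for m
    proof -
      have "sqrt (graph_inner (X m - u) (X m - u)) \<le> e / 2"
        using N that \<open>e > 0\<close> by (intro real_le_lsqrt) auto
      moreover have "0 \<le> sqrt (graph_inner (X m - u) (X m - u))"
        using norm_le[of "X m - u"] norm_ge_zero[of "X m - u"] by linarith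
      ultimately show ?thesis
        using \<open>e > 0\<close> by simp
    qed
    then show "\<exists>N. \<forall>m\<ge>N. norm (sqrt (graph_inner (X m - u) (X m - u)) - 0) < e"
      by blast
  qed
  ultimately show ?thesis
    by (rule that)
qed

lemma hilbert_space_on_dom_space: "hilbert_space_on dom_space graph_inner"
  unfolding hilbert_space_on_def
proof (intro conjI ballI allI impI)
  show "subspace dom_space"
    by (rule subspace_dom_space)
  show "graph_inner u v = graph_inner v u" for u v
    by (simp add: graph_inner_def inner_commute)
  show "graph_inner (u + v) z = graph_inner u z + graph_inner v z"
    if "u \<in> dom_space" "v \<in> dom_space" "z \<in> dom_space" for u v z
    \<comment> \<open>Splitting the infinite sum relies on convergence of both mixed series.\<close>
    using infsum_add[OF summable_inner[OF that(1,3)] summable_inner[OF that(2,3)]]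
    by (simp add: graph_inner_def linear_add[OF linear_T] inner_add_left distrib_left)
  show "graph_inner (c *\<^sub>R u) v = c * graph_inner u v" for c u v
    by (simp add: graph_inner_def linear_scale[OF linear_T] infsum_cmult_right' distrib_left
        mult.left_commute)
  show "0 \<le> graph_inner u u" for u
    using norm_le_graph_inner[of u] by (rule order_trans[rotated]) simp
  show "u = 0" if "graph_inner u u = 0" for u
    using norm_le_graph_inner[of u] that by simp
  fix X :: "nat \<Rightarrow> 'a"
  assume X: "range X \<subseteq> dom_space"
    and Cauchy: "\<forall>e>0. \<exists>N. \<forall>m\<ge>N. \<forall>n\<ge>N. sqrt (graph_inner (X m - X n) (X m - X n)) < e"
  show "\<exists>u\<in>dom_space. (\<lambda>n. sqrt (graph_inner (X n - u) (X n - u))) \<longlonglongrightarrow> 0"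
    by (rule complete_graph_inner[OF X]) (use Cauchy in blast)+
qed

end


section \<open>The texture space\<close>

text \<open>The summability claim guarantees that on the texture space the inner product is the
  genuine value of the series and not the default 0 of a divergent sum.\<close>

theorem proposition6p5:
  fixes r \<sigma>\<^sub>0 s :: real
  assumes "r > 1" and "\<sigma>\<^sub>0 > 0"
  shows "(\<forall>u \<in> (texture_space r \<sigma>\<^sub>0 s :: 'n::finite L2 set). \<forall>v \<in> texture_space r \<sigma>\<^sub>0 s.
            (\<lambda>j :: int. r powr (2 * of_int j * s) * (conv_Phi r \<sigma>\<^sub>0 j u \<bullet> conv_Phi r \<sigma>\<^sub>0 j v))
              summable_on UNIV) \<and>
         hilbert_space_on (texture_space r \<sigma>\<^sub>0 s :: 'n L2 set) (texture_inner r \<sigma>\<^sub>0 s)"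
proof -
  interpret weighted_operators "conv_Phi r \<sigma>\<^sub>0 :: int \<Rightarrow> 'n L2 \<Rightarrow> 'n L2"
    "\<lambda>j. r powr (2 * of_int j * s)"
    by (rule weighted_operators.intro) (simp_all add: bounded_linear_conv_Phi)
  have "texture_space r \<sigma>\<^sub>0 s = dom_space"
    by (simp add: texture_space_def dom_space_def)
  moreover have "texture_inner r \<sigma>\<^sub>0 s = graph_inner"
    by (simp add: fun_eq_iff texture_inner_def graph_inner_def)
  ultimately show ?thesis
    using summable_inner hilbert_space_on_dom_space by simp
qed

end
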